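(* Let $r,s\in(0,+\infty)$ with $s<r$, and let $X$ be a random variable taking values in $\mathbb{R}^d$ with distribution $P=f\cdot\lambda_d$. Let $\theta>0$ and $\mu\in\mathbb{R}^d$ be such that $(\theta,\mu)$ is $P$-admissible, and suppose $\mathbb{E}|X|^{r+\eta}<\infty$ for some $\eta>0$. Let $(\alpha_n)_{n\ge1}$ be an asymptotically $L^r(P)$-optimal sequence of quantizers. If $$\int_{\{f>0\}}f_{\theta,\mu}^{\frac{r}{r-s}}\,f^{-\frac{s}{r-s}}\,d\lambda_d<+\infty,$$ then $(\alpha_n^{\theta,\mu})_{n\ge1}$ is $L^s(P)$-rate-optimal and $$\limsup_{n\to+\infty}n^{s/d}\,\|X-\widehat X^{\alpha_n^{\theta,\mu}}\|_s^s\;\le\;\theta^{s+d}\,\bigl(Q_r(P)\bigr)^{s/r}\left(\int_{\{f>0\}}f_{\theta,\mu}^{\frac{r}{r-s}}\,f^{-\frac{s}{r-s}}\,d\lambda_d\right)^{1-\frac{s}{r}}.$$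
   Context: $\lambda_d$ is Lebesgue measure on $\mathbb{R}^d$, $|\cdot|$ is a norm on $\mathbb{R}^d$, and $d(x,\alpha)=\min_{a\in\alpha}|x-a|$ for a finite nonempty $\alpha\subset\mathbb{R}^d$. $\widehat X^{\alpha}$ denotes a Voronoi quantization (nearest-neighbour projection) of $X$ on $\alpha$, so $\|X-\widehat X^{\alpha}\|_s^s=\mathbb{E}\,d(X,\alpha)^s$. A sequence of quantizers $(\alpha_n)_{n\ge1}$ is a sequence of finite nonempty sets $\alpha_n\subset\mathbb{R}^d$ with $\mathrm{card}(\alpha_n)\le n$. For a probability $P$ put $e_{n,r}(P)=\inf_{\mathrm{card}(\alpha)\le n}\left(\int d(x,\alpha)^r dP(x)\right)^{1/r}$. $J_{r,d}=\inf_{n\ge1}n^{r/d}e_{n,r}^r(U([0,1]^d))\in(0,\infty)$, where $U([0,1]^d)$ is the uniform distribution on $[0,1]^d$, and $Q_r(P)=J_{r,d}\left(\int f^{d/(d+r)}d\lambda_d\right)^{(d+r)/d}$. The sequence $(\alpha_n)$ is asymptotically $L^r(P)$-optimal if $\lim_n n^{r/d}\int d(x,\alpha_n)^r dP(x)=Q_r(P)$. A sequence $(\beta_n)$ is $L^s(P)$-rate-optimal if $\limsup_n n^{s/d}\int d(x,\beta_n)^s dP(x)<+\infty$. For $\theta>0$, $\mu\in\mathbb{R}^d$: $\alpha_n^{\theta,\mu}=\{\mu+\theta(a-\mu):a\in\alpha_n\}$ and $f_{\theta,\mu}(x)=f(\mu+\theta(x-\mu))$. For $P=f\cdot\lambda_d$,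 the couple $(\theta,\mu)$ is $P$-admissible if $\{f>0\}\subset\mu(1-\theta)+\theta\{f>0\}$ up to a $\lambda_d$-null set. *)

theory Defs
  imports "HOL-Probability.Probability"
begin

text \<open>The space is \<^typ>\<open>real^'d\<close>, of dimension \<^term>\<open>CARD('d)\<close>. The norm in the error
  criteria is an arbitrary norm \<^term>\<open>N\<close>, not the Euclidean norm of the library.\<close>

definition is_norm :: "(real^'d \<Rightarrow> real) \<Rightarrow> bool" where
  "is_norm N \<longleftrightarrow>
     (\<forall>x. N x \<ge> 0) \<and>
     (\<forall>x. N x = 0 \<longleftrightarrow> x = 0) \<and>
     (\<forall>c x. N (c *\<^sub>R x) = \<bar>c\<bar> * N x) \<and>
     (\<forall>x y. N (x + y) \<le> N x + N y)"

text \<open>Powers with positive exponent on the extended half-line; the library has none. Integrals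
  are nonnegative and \<^typ>\<open>ennreal\<close>-valued throughout, so a divergent one is \<open>\<infinity>\<close>, not 0.\<close>

definition epowr :: "ennreal \<Rightarrow> real \<Rightarrow> ennreal" where
  "epowr x p = (if x = \<infinity> then \<infinity> else ennreal (enn2real x powr p))"

definition quant_dist :: "(real^'d \<Rightarrow> real) \<Rightarrow> real^'d \<Rightarrow> (real^'d) set \<Rightarrow> real" where
  "quant_dist N x A = Min ((\<lambda>a. N (x - a)) ` A)"

definition distortion ::
  "(real^'d \<Rightarrow> real) \<Rightarrow> real \<Rightarrow> (real^'d) measure \<Rightarrow> (real^'d) set \<Rightarrow> ennreal" where
  "distortion N r P A = (\<integral>\<^sup>+x. ennreal (quant_dist N x A powr r) \<partial>P)"

definition min_quant_error ::
  "(real^'d \<Rightarrow> real) \<Rightarrow> nat \<Rightarrow> real \<Rightarrow> (real^'d) measure \<Rightarrow> ennreal" where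
  "min_quant_error N n r P =
     (INF A\<in>{A. finite A \<and> A \<noteq> {} \<and> card A \<le> n}. epowr (distortion N r P A) (1 / r))"

definition J_const :: "(real^'d \<Rightarrow> real) \<Rightarrow> real \<Rightarrow> ennreal" where
  "J_const N r =
     (INF n\<in>{1..}. ennreal (real n powr (r / real CARD('d))) *
        epowr (min_quant_error N n r (uniform_measure lborel (cbox (0 :: real^'d) 1))) r)"

definition Q_const :: "(real^'d \<Rightarrow> real) \<Rightarrow> real \<Rightarrow> (real^'d \<Rightarrow> real) \<Rightarrow> ennreal" where
  "Q_const N r f =
     J_const N r *
     epowr (\<integral>\<^sup>+x. ennreal (f x powr (real CARD('d) / (real CARD('d) + r))) \<partial>lborel)
       ((real CARD('d) + r) / real CARD('d))"

text \<open>Sequences are indexed from 1; the value at 0 is irrelevant.\<close>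

definition quantizer_seq :: "(nat \<Rightarrow> (real^'d) set) \<Rightarrow> bool" where
  "quantizer_seq \<alpha> \<longleftrightarrow> (\<forall>n\<ge>1. finite (\<alpha> n) \<and> \<alpha> n \<noteq> {} \<and> card (\<alpha> n) \<le> n)"

text \<open>The density \<^term>\<open>f\<close> stands for \<open>P = f \<cdot> \<lambda>\<close> in the next definition and in
  \<open>admissible\<close>.\<close>

definition asymptotically_optimal ::
  "(real^'d \<Rightarrow> real) \<Rightarrow> real \<Rightarrow> (real^'d \<Rightarrow> real) \<Rightarrow> (nat \<Rightarrow> (real^'d) set) \<Rightarrow> bool" where
  "asymptotically_optimal N r f \<alpha> \<longleftrightarrow>
     quantizer_seq \<alpha> \<and>
     (\<lambda>n. ennreal (real n powr (r / real CARD('d))) *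
            distortion N r (density lborel (\<lambda>x. ennreal (f x))) (\<alpha> n))
       \<longlonglongrightarrow> Q_const N r f"

definition rate_optimal ::
  "(real^'d \<Rightarrow> real) \<Rightarrow> real \<Rightarrow> (real^'d) measure \<Rightarrow> (nat \<Rightarrow> (real^'d) set) \<Rightarrow> bool" where
  "rate_optimal N s P \<beta> \<longleftrightarrow>
     quantizer_seq \<beta> \<and>
     limsup (\<lambda>n. ennreal (real n powr (s / real CARD('d))) * distortion N s P (\<beta> n)) < \<infinity>"

definition dilate_set :: "real \<Rightarrow> real^'d \<Rightarrow> (real^'d) set \<Rightarrow> (real^'d) set" where
  "dilate_set \<theta> \<mu> A = (\<lambda>a. \<mu> + \<theta> *\<^sub>R (a - \<mu>)) ` A"

definition dilate_fun :: "real \<Rightarrow> real^'d \<Rightarrow> (real^'d \<Rightarrow> real) \<Rightarrow> real^'d \<Rightarrow> real" where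
  "dilate_fun \<theta> \<mu> f x = f (\<mu> + \<theta> *\<^sub>R (x - \<mu>))"

definition admissible :: "(real^'d \<Rightarrow> real) \<Rightarrow> real \<Rightarrow> real^'d \<Rightarrow> bool" where
  "admissible f \<theta> \<mu> \<longleftrightarrow>
     (AE x in lborel. x \<in> {y. f y > 0} \<longrightarrow>
        x \<in> (\<lambda>y. (1 - \<theta>) *\<^sub>R \<mu> + \<theta> *\<^sub>R y) ` {y. f y > 0})"

text \<open>The Voronoi quantization of \<^term>\<open>X\<close> on \<^term>\<open>A\<close> is \<open>\<pi> \<circ> X\<close> for such a projection \<open>\<pi>\<close>;
  ties are broken in an arbitrary Borel way.\<close>

definition voronoi_projection ::
  "(real^'d \<Rightarrow> real) \<Rightarrow> (real^'d) set \<Rightarrow> (real^'d \<Rightarrow> real^'d) \<Rightarrow> bool" where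
  "voronoi_projection N A \<pi> \<longleftrightarrow>
     \<pi> \<in> borel_measurable borel \<and> (\<forall>x. \<pi> x \<in> A \<and> N (x - \<pi> x) = quant_dist N x A)"

definition Lnorm ::
  "(real^'d \<Rightarrow> real) \<Rightarrow> 'a measure \<Rightarrow> real \<Rightarrow> ('a \<Rightarrow> real^'d) \<Rightarrow> ennreal" where
  "Lnorm N M s Y = epowr (\<integral>\<^sup>+\<omega>. ennreal (N (Y \<omega>) powr s) \<partial>M) (1 / s)"

definition dilation_integral ::
  "real \<Rightarrow> real \<Rightarrow> (real^'d \<Rightarrow> real) \<Rightarrow> real \<Rightarrow> real^'d \<Rightarrow> ennreal" where
  "dilation_integral r s f \<theta> \<mu> =
     (\<integral>\<^sup>+x\<in>{x. f x > 0}.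
        ennreal (dilate_fun \<theta> \<mu> f x powr (r / (r - s)) * f x powr (- (s / (r - s)))) \<partial>lborel)"

end

theory Submission
  imports Defs
begin

text \<open>The substitution \<open>x = \<mu> + \<theta> (z - \<mu>)\<close> turns the \<open>s\<close>-distortion of the dilated quantizer
  into \<open>\<theta>\<^sup>s\<^sup>+\<^sup>d \<integral> d(z, \<alpha>\<^sub>n)\<^sup>s f\<^sub>\<theta>\<^sub>,\<^sub>\<mu>(z) dz\<close>. Admissibility says exactly that \<open>f\<^sub>\<theta>\<^sub>,\<^sub>\<mu>\<close> vanishes almost
  everywhere off \<open>{f > 0}\<close>, so that one may write the integrand as the product of
  \<open>(d(z, \<alpha>\<^sub>n)\<^sup>r f)\<^sup>s\<^sup>/\<^sup>r\<close> and \<open>f\<^sub>\<theta>\<^sub>,\<^sub>\<mu> f\<^sup>-\<^sup>s\<^sup>/\<^sup>r\<close>. Hoelder's inequality with the conjugate exponents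
  \<open>r/s\<close> and \<open>r/(r - s)\<close> then bounds the integral by a power of the \<open>r\<close>-distortion of \<open>\<alpha>\<^sub>n\<close> times a power
  of the dilation integral (lemma \<open>distortion_dilate_le\<close>). After multiplication by
  \<open>n\<^sup>s\<^sup>/\<^sup>d = (n\<^sup>r\<^sup>/\<^sup>d)\<^sup>s\<^sup>/\<^sup>r\<close>, asymptotic optimality gives the bound on the upper limit.

  Rate optimality asks in addition that this bound be finite, which follows from
  \<open>Q\<^sub>r(P) < \<infinity>\<close> (lemma \<open>Q_const_finite\<close>). This is where the moment of order \<open>r + \<eta>\<close> enters: a second use of
  Hoelder's inequality, against a power of \<open>1 + |x|\<close> that is integrable at infinity, bounds
  \<open>\<integral> f\<^sup>d\<^sup>/\<^sup>(\<^sup>d\<^sup>+\<^sup>r\<^sup>)\<close>.\<close>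

section \<open>Powers on the extended half-line\<close>

lemma epowr_ennreal [simp]: "0 \<le> x \<Longrightarrow> epowr (ennreal x) p = ennreal (x powr p)"
  by (simp add: epowr_def)

lemma epowr_top [simp]: "epowr top p = top"
  by (simp add: epowr_def)

lemma epowr_0 [simp]: "epowr 0 p = 0"
  by (simp add: epowr_def)

lemma epowr_less_top: "x < top \<Longrightarrow> epowr x p < top"
  by (simp add: epowr_def)

lemma epowr_pos: "0 < x \<Longrightarrow> 0 < epowr x p"
  by (cases x) auto

lemma epowr_mult: "epowr (x * y) p = epowr x p * epowr y p"
proof (cases "x = 0 \<or> y = 0")
  case False
  then have "0 < x" "0 < y"
    by (auto simp: zero_less_iff_neq_zero)
  then show ?thesis
    using epowr_pos[of x p] epowr_pos[of y p]
    by (cases x; cases y) (auto simp: ennreal_mult[symmetric] powr_mult ennreal_mult_top ennreal_top_mult)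
qed auto

lemma epowr_epowr_inverse: "p \<noteq> 0 \<Longrightarrow> epowr (epowr x (1 / p)) p = x"
  by (cases x) (auto simp: powr_powr)

lemma tendsto_epowr:
  assumes "(u \<longlongrightarrow> x) F" "x < top" "0 < p"
  shows "((\<lambda>n. epowr (u n) p) \<longlongrightarrow> epowr x p) F"
proof -
  obtain y where y: "0 \<le> y" "x = ennreal y"
    using \<open>x < top\<close> by (cases x) auto
  have "((\<lambda>n. enn2real (u n) powr p) \<longlongrightarrow> y powr p) F"
    by (rule tendsto_powr') (use assms y in \<open>auto intro: tendsto_enn2real\<close>)
  then have "((\<lambda>n. ennreal (enn2real (u n) powr p)) \<longlongrightarrow> ennreal (y powr p)) F"
    by (rule tendsto_ennrealI)
  moreover have "\<forall>\<^sub>F n in F. u n < top"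
    using order_tendstoD(2)[OF assms(1,2)] .
  then have "\<forall>\<^sub>F n in F. ennreal (enn2real (u n) powr p) = epowr (u n) p"
    by eventually_elim (auto simp: epowr_def)
  ultimately show ?thesis
    using y by (simp add: tendsto_cong)
qed

text \<open>When both integrals are positive and finite, the weighted inequality between the arithmetic
  and the geometric mean, applied pointwise to \<open>F / \<integral>F\<close> and \<open>G / \<integral>G\<close>, integrates to the claim.
  If one of the integrals is zero, the product vanishes almost everywhere; otherwise an infinite one makes the right-hand side infinite.\<close>

lemma nn_integral_Hoelder:
  fixes F G :: "'a \<Rightarrow> real"
  assumes [measurable]: "F \<in> borel_measurable M" "G \<in> borel_measurable M"
    and nonneg: "\<And>x. 0 \<le> F x" "\<And>x. 0 \<le> G x" and p: "0 < p" "p < 1"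
  shows "(\<integral>\<^sup>+x. ennreal (F x powr p * G x powr (1 - p)) \<partial>M)
    \<le> epowr (\<integral>\<^sup>+x. ennreal (F x) \<partial>M) p * epowr (\<integral>\<^sup>+x. ennreal (G x) \<partial>M) (1 - p)"
    (is "?L \<le> epowr ?A p * epowr ?B (1 - p)")
proof -
  consider "?A = 0 \<or> ?B = 0" | "0 < ?A" "0 < ?B" "?A = top \<or> ?B = top"
    | "0 < ?A" "0 < ?B" "?A < top" "?B < top"
    by (metis less_top zero_less_iff_neq_zero)
  then show ?thesis
  proof cases
    case 1
    then have "AE x in M. F x = 0 \<or> G x = 0"
      by (auto simp: nn_integral_0_iff_AE nonneg antisym elim!: eventually_mono)
    then have "?L = (\<integral>\<^sup>+x. 0 \<partial>M)"
      by (intro nn_integral_cong_AE) (auto elim!: eventually_mono)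
    then show ?thesis
      by simp
  next
    case 2
    then have "epowr ?A p * epowr ?B (1 - p) = top"
      using epowr_pos[of ?A p] epowr_pos[of ?B "1 - p"]
      by (auto simp: ennreal_mult_top ennreal_top_mult)
    then show ?thesis
      by simp
  next
    case 3
    obtain a where a: "0 < a" "?A = ennreal a"
      using 3 by (cases ?A) (auto simp: ennreal_less_zero_iff)
    obtain b where b: "0 < b" "?B = ennreal b"
      using 3 by (cases ?B) (auto simp: ennreal_less_zero_iff)
    define c where "c = a powr p * b powr (1 - p)"
    have "0 \<le> c"
      by (simp add: c_def)
    have "F x powr p * G x powr (1 - p) \<le> c * (p / a) * F x + c * ((1 - p) / b) * G x" for x
    proof (cases "F x = 0 \<or> G x = 0")
      case True
      have "0 \<le> c * (p / a) * F x + c * ((1 - p) / b) * G x"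
        using nonneg p a b \<open>0 \<le> c\<close> by (intro add_nonneg_nonneg mult_nonneg_nonneg divide_nonneg_pos) auto
      with True show ?thesis
        by auto
    next
      case False
      then have pos: "0 < F x" "0 < G x"
        using nonneg by (auto simp: less_le)
      have "F x powr p * G x powr (1 - p) = c * ((F x / a) powr p * (G x / b) powr (1 - p))"
        using a b pos by (simp add: c_def powr_divide)
      also have "\<dots> \<le> c * (p * (F x / a) + (1 - p) * (G x / b))"
        using p pos a b \<open>0 \<le> c\<close> by (intro mult_left_mono Youngs_inequality_0) auto
      finally show ?thesis
        by (simp add: distrib_left)
    qed
    then have "?L \<le> (\<integral>\<^sup>+x. ennreal (c * (p / a)) * ennreal (F x)
        + ennreal (c * ((1 - p) / b)) * ennreal (G x) \<partial>M)"
      using nonneg p a b \<open>0 \<le> c\<close>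
      by (intro nn_integral_mono)
        (simp add: ennreal_mult[symmetric] ennreal_plus[symmetric] ennreal_leI del: ennreal_plus)
    also have "\<dots> = ennreal (c * (p / a)) * ?A + ennreal (c * ((1 - p) / b)) * ?B"
      by (simp add: nn_integral_add nn_integral_cmult)
    also have "\<dots> = ennreal (c * (p / a) * a + c * ((1 - p) / b) * b)"
      using a b p \<open>0 \<le> c\<close>
      by (simp add: ennreal_mult[symmetric] ennreal_plus[symmetric] del: ennreal_plus)
    also have "c * (p / a) * a + c * ((1 - p) / b) * b = c"
      using a b by (simp add: field_simps)
    also have "ennreal c = epowr ?A p * epowr ?B (1 - p)"
      using a b by (simp add: c_def ennreal_mult)
    finally show ?thesis .
  qed
qed

section \<open>Norms and the quantization distance\<close>

text \<open>A norm is convex, and a finite convex function on a finite-dimensional space is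
  continuous.\<close>

lemma continuous_on_is_norm:
  fixes N :: "real^'d \<Rightarrow> real"
  assumes "is_norm N"
  shows "continuous_on UNIV N"
proof -
  have "convex_on UNIV N"
  proof (rule convex_onI)
    fix t :: real and x y :: "real^'d"
    assume "0 < t" "t < 1"
    have "N ((1 - t) *\<^sub>R x + t *\<^sub>R y) \<le> N ((1 - t) *\<^sub>R x) + N (t *\<^sub>R y)"
      using assms unfolding is_norm_def by blast
    also have "\<dots> = (1 - t) * N x + t * N y"
      using assms \<open>0 < t\<close> \<open>t < 1\<close> by (simp add: is_norm_def)
    finally show "N ((1 - t) *\<^sub>R x + t *\<^sub>R y) \<le> (1 - t) * N x + t * N y" .
  qed auto
  then show ?thesis
    by (rule convex_on_continuous[OF open_UNIV])
qed

lemma borel_measurable_is_norm: "is_norm N \<Longrightarrow> N \<in> borel_measurable borel"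
  by (intro borel_measurable_continuous_onI continuous_on_is_norm)

text \<open>On a finite-dimensional space any norm dominates the Euclidean one, by compactness of the
  unit sphere.\<close>

lemma norm_le_is_norm:
  assumes "is_norm N"
  obtains K where "0 < K" "\<And>x. norm x \<le> K * N x"
proof -
  have "\<exists>x\<in>sphere 0 1. \<forall>y\<in>sphere 0 1. N x \<le> N y"
    by (intro continuous_attains_inf continuous_on_subset[OF continuous_on_is_norm[OF assms]]) auto
  then obtain x0 where x0: "norm x0 = 1" "\<And>y. norm y = 1 \<Longrightarrow> N x0 \<le> N y"
    by auto
  have pos: "0 < N x0"
    using x0 assms unfolding is_norm_def by (metis less_le norm_zero zero_neq_one)
  have "norm x \<le> 1 / N x0 * N x" for x
  proof (cases "x = 0")
    case True
    then show ?thesis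
      using pos assms by (simp add: is_norm_def)
  next
    case False
    have "N x0 \<le> N ((1 / norm x) *\<^sub>R x)"
      using False by (intro x0) auto
    also have "\<dots> = N x / norm x"
      using assms by (simp add: is_norm_def)
    finally show ?thesis
      using False pos by (simp add: field_simps)
  qed
  then show ?thesis
    using pos by (intro that[of "1 / N x0"]) auto
qed

lemma quant_dist_nonneg:
  assumes "is_norm N" "finite A" "A \<noteq> {}"
  shows "0 \<le> quant_dist N x A"
  using assms by (auto simp: quant_dist_def is_norm_def Min_ge_iff)

lemma borel_measurable_quant_dist:
  assumes "is_norm N" "finite A"
  shows "(\<lambda>x. quant_dist N x A) \<in> borel_measurable borel"
proof -
  note borel_measurable_is_norm[OF assms(1), measurable]
  show ?thesis
    unfolding quant_dist_def using assms(2) by measurable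
qed

lemma quant_dist_dilate:
  assumes "is_norm N" "0 < \<theta>" "finite A" "A \<noteq> {}"
  shows "quant_dist N (\<mu> + \<theta> *\<^sub>R (z - \<mu>)) (dilate_set \<theta> \<mu> A) = \<theta> * quant_dist N z A"
proof -
  have "mono ((*) \<theta>)"
    using assms by (auto intro!: monoI)
  have N: "N ((\<mu> + \<theta> *\<^sub>R (z - \<mu>)) - (\<mu> + \<theta> *\<^sub>R (a - \<mu>))) = \<theta> * N (z - a)" for a
  proof -
    have "\<mu> + \<theta> *\<^sub>R (z - \<mu>) - (\<mu> + \<theta> *\<^sub>R (a - \<mu>)) = \<theta> *\<^sub>R (z - a)"
      by (simp add: algebra_simps)
    then show ?thesis
      using assms by (simp add: is_norm_def)
  qed
  show ?thesis
    using assms mono_Min_commute[OF \<open>mono ((*) \<theta>)\<close>, of "(\<lambda>a. N (z - a)) ` A"]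
    unfolding quant_dist_def dilate_set_def image_image N by simp
qed

lemma quantizer_seq_dilate:
  assumes "quantizer_seq \<alpha>"
  shows "quantizer_seq (\<lambda>n. dilate_set \<theta> \<mu> (\<alpha> n))"
  using assms unfolding quantizer_seq_def dilate_set_def
  by (auto intro: order.trans[OF card_image_le])

lemma distortion_eq_Lnorm:
  assumes "is_norm N" "s \<noteq> 0" "finite A" "distributed M lborel X (\<lambda>x. ennreal (f x))"
    and "voronoi_projection N A \<pi>"
  shows "epowr (Lnorm N M s (\<lambda>\<omega>. X \<omega> - \<pi> (X \<omega>))) s
    = distortion N s (density lborel (\<lambda>x. ennreal (f x))) A"
proof -
  have [measurable]: "X \<in> borel_measurable M"
    using distributed_measurable[OF assms(4)] by (simp only: measurable_lborel1)
  note borel_measurable_quant_dist[OF assms(1,3), measurable]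
  have "distortion N s (density lborel (\<lambda>x. ennreal (f x))) A
    = (\<integral>\<^sup>+\<omega>. ennreal (quant_dist N (X \<omega>) A powr s) \<partial>M)"
    unfolding distortion_def distributed_distr_eq_density[OF assms(4), symmetric]
    by (subst nn_integral_distr) auto
  then show ?thesis
    using assms by (simp add: Lnorm_def epowr_epowr_inverse voronoi_projection_def)
qed

section \<open>Distortion of a dilated quantizer\<close>

lemma nn_integral_lborel_dilate:
  fixes \<mu> :: "'a::euclidean_space"
  assumes "g \<in> borel_measurable borel" "0 < \<theta>"
  shows "(\<integral>\<^sup>+x. g x \<partial>lborel) = ennreal (\<theta> ^ DIM('a)) * (\<integral>\<^sup>+z. g (\<mu> + \<theta> *\<^sub>R (z - \<mu>)) \<partial>lborel)"
proof -
  note assms(1)[measurable]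
  have T: "\<mu> + \<theta> *\<^sub>R (z - \<mu>) = (\<mu> - \<theta> *\<^sub>R \<mu>) + \<theta> *\<^sub>R z" for z
    by (simp add: algebra_simps)
  show ?thesis
    unfolding T using assms(2)
    by (subst lborel_affine[of \<theta> "\<mu> - \<theta> *\<^sub>R \<mu>"])
      (auto simp: nn_integral_density nn_integral_distr nn_integral_cmult)
qed

text \<open>Pulled back along the dilation, admissibility becomes absolute continuity of the dilated
  density with respect to the original one.\<close>

lemma admissible_AE_pos:
  fixes f :: "real^'d \<Rightarrow> real"
  assumes "admissible f \<theta> \<mu>" "0 < \<theta>"
  shows "AE z in lborel. 0 < dilate_fun \<theta> \<mu> f z \<longrightarrow> 0 < f z"
proof -
  define T where "T = (\<lambda>z. (\<mu> - \<theta> *\<^sub>R \<mu>) + \<theta> *\<^sub>R z)"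
  have [measurable]: "T \<in> borel_measurable borel"
    by (simp add: T_def)
  have T: "T z = \<mu> + \<theta> *\<^sub>R (z - \<mu>)" for z
    by (simp add: T_def algebra_simps)
  have T_alt: "T = (\<lambda>z. (1 - \<theta>) *\<^sub>R \<mu> + \<theta> *\<^sub>R z)"
    by (simp add: T_def algebra_simps)
  have "inj T"
    using assms(2) by (auto simp: T_def inj_def)
  have L: "lborel = density (distr lborel borel T) (\<lambda>_. ennreal (\<bar>\<theta>\<bar> ^ DIM(real^'d)))"
    using lborel_affine[of \<theta> "\<mu> - \<theta> *\<^sub>R \<mu>"] assms(2) by (simp add: T_def)
  have "AE x in lborel. 0 < f x \<longrightarrow> x \<in> T ` {y. 0 < f y}"
    using assms(1) by (simp add: admissible_def T_alt)
  then have "AE x in density (distr lborel borel T) (\<lambda>_. ennreal (\<bar>\<theta>\<bar> ^ DIM(real^'d))).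
      0 < f x \<longrightarrow> x \<in> T ` {y. 0 < f y}"
    by (subst (asm) L)
  then have "AE x in distr lborel borel T. 0 < f x \<longrightarrow> x \<in> T ` {y. 0 < f y}"
    using assms(2) by (subst (asm) AE_density) auto
  then have "AE z in lborel. 0 < f (T z) \<longrightarrow> T z \<in> T ` {y. 0 < f y}"
    by (rule AE_distrD[rotated]) auto
  then show ?thesis
    unfolding inj_image_mem_iff[OF \<open>inj T\<close>] by (simp add: dilate_fun_def T)
qed

lemma distortion_dilate_le:
  fixes f :: "real^'d \<Rightarrow> real"
  assumes N: "is_norm N" and rs: "0 < s" "s < r" and f: "\<And>x. 0 \<le> f x"
    and [measurable]: "f \<in> borel_measurable borel"
    and \<theta>: "0 < \<theta>" "admissible f \<theta> \<mu>" and A: "finite A" "A \<noteq> {}"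
  shows "distortion N s (density lborel (\<lambda>x. ennreal (f x))) (dilate_set \<theta> \<mu> A)
    \<le> ennreal (\<theta> powr (s + real CARD('d)))
      * (epowr (distortion N r (density lborel (\<lambda>x. ennreal (f x))) A) (s / r)
        * epowr (dilation_integral r s f \<theta> \<mu>) (1 - s / r))"
proof -
  let ?P = "density lborel (\<lambda>x. ennreal (f x))"
  define \<delta> where "\<delta> = (\<lambda>z. quant_dist N z A)"
  define h where "h = dilate_fun \<theta> \<mu> f"
  define F where "F z = \<delta> z powr r * f z" for z
  define G where "G z = h z powr (r / (r - s)) * f z powr - (s / (r - s)) * indicator {z. 0 < f z} z" for z
  have [measurable]: "\<delta> \<in> borel_measurable borel" "h \<in> borel_measurable borel"
    unfolding \<delta>_def h_def dilate_fun_def using borel_measurable_quant_dist[OF N A(1)] by auto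
  have [measurable]: "(\<lambda>x. quant_dist N x (dilate_set \<theta> \<mu> A)) \<in> borel_measurable borel"
    using A by (intro borel_measurable_quant_dist N) (simp add: dilate_set_def)
  have \<delta>: "0 \<le> \<delta> z" for z
    by (simp add: \<delta>_def quant_dist_nonneg N A)
  have h: "0 \<le> h z" for z
    by (simp add: h_def dilate_fun_def f)
  have [measurable]: "F \<in> borel_measurable borel" "G \<in> borel_measurable borel"
    by (simp_all add: F_def[abs_def] G_def[abs_def])
  have "distortion N s ?P (dilate_set \<theta> \<mu> A)
      = (\<integral>\<^sup>+x. ennreal (f x) * ennreal (quant_dist N x (dilate_set \<theta> \<mu> A) powr s) \<partial>lborel)"
    unfolding distortion_def by (subst nn_integral_density) auto
  also have "\<dots> = ennreal (\<theta> ^ CARD('d))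
      * (\<integral>\<^sup>+z. ennreal (h z) * ennreal ((\<theta> * \<delta> z) powr s) \<partial>lborel)"
    using \<theta> A N by (subst nn_integral_lborel_dilate[where \<theta> = \<theta> and \<mu> = \<mu>])
      (auto simp: quant_dist_dilate h_def dilate_fun_def \<delta>_def)
  also have "(\<integral>\<^sup>+z. ennreal (h z) * ennreal ((\<theta> * \<delta> z) powr s) \<partial>lborel)
      = (\<integral>\<^sup>+z. ennreal (\<theta> powr s) * ennreal (\<delta> z powr s * h z) \<partial>lborel)"
    using \<theta> \<delta> h by (intro nn_integral_cong) (simp add: powr_mult ennreal_mult[symmetric] mult_ac)
  also have "\<dots> = ennreal (\<theta> powr s) * (\<integral>\<^sup>+z. ennreal (\<delta> z powr s * h z) \<partial>lborel)"
    by (subst nn_integral_cmult) auto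
  also have "(\<integral>\<^sup>+z. ennreal (\<delta> z powr s * h z) \<partial>lborel)
      = (\<integral>\<^sup>+z. ennreal (F z powr (s / r) * G z powr (1 - s / r)) \<partial>lborel)"
  proof (rule nn_integral_cong_AE)
    have "AE z in lborel. 0 < h z \<longrightarrow> 0 < f z"
      unfolding h_def by (rule admissible_AE_pos[OF \<theta>(2,1)])
    \<comment> \<open>Off \<open>{f > 0}\<close> the right-hand side is zero by the indicator in \<open>G\<close>, the left-hand side
      only by admissibility.\<close>
    then show "AE z in lborel. ennreal (\<delta> z powr s * h z)
        = ennreal (F z powr (s / r) * G z powr (1 - s / r))"
    proof eventually_elim
      case (elim z)
      show ?case
      proof (cases "0 < f z")
        case True
        have e: "r / (r - s) * (1 - s / r) = 1" "s / (r - s) * (1 - s / r) = s / r"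
          using rs by (simp_all add: field_simps)
        have "r \<noteq> 0"
          using rs by simp
        have "F z powr (s / r) = \<delta> z powr s * f z powr (s / r)"
          using \<delta>[of z] True \<open>r \<noteq> 0\<close> by (simp add: F_def powr_mult powr_powr)
        moreover have "G z powr (1 - s / r) = h z * f z powr - (s / r)"
          using h[of z] True e \<open>r \<noteq> 0\<close> by (simp add: G_def powr_mult powr_powr)
        moreover have "f z powr (s / r) * f z powr - (s / r) = 1"
          using True by (simp add: powr_add[symmetric])
        ultimately show ?thesis
          by (simp add: mult_ac)
      next
        case False
        then have "h z = 0"
          using elim h[of z] by force
        with False show ?thesis
          by (simp add: G_def)
      qed
    qed
  qed
  also have "ennreal (\<theta> ^ CARD('d)) * (ennreal (\<theta> powr s) * \<dots>)
      = ennreal (\<theta> powr (s + real CARD('d))) * \<dots>"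
    using \<theta> by (simp add: powr_add powr_realpow ennreal_mult mult_ac)
  also have "\<dots> \<le> ennreal (\<theta> powr (s + real CARD('d)))
      * (epowr (\<integral>\<^sup>+z. ennreal (F z) \<partial>lborel) (s / r)
        * epowr (\<integral>\<^sup>+z. ennreal (G z) \<partial>lborel) (1 - s / r))"
    using rs \<delta> h f by (intro mult_left_mono nn_integral_Hoelder) (auto simp: F_def G_def)
  also have "(\<integral>\<^sup>+z. ennreal (F z) \<partial>lborel) = distortion N r ?P A"
  proof -
    have "distortion N r ?P A = (\<integral>\<^sup>+z. ennreal (\<delta> z powr r) \<partial>?P)"
      by (simp add: distortion_def \<delta>_def)
    also have "\<dots> = (\<integral>\<^sup>+z. ennreal (f z) * ennreal (\<delta> z powr r) \<partial>lborel)"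
      by (subst nn_integral_density) auto
    finally show ?thesis
      using f by (simp add: F_def ennreal_mult mult.commute)
  qed
  also have "(\<integral>\<^sup>+z. ennreal (G z) \<partial>lborel) = dilation_integral r s f \<theta> \<mu>"
    unfolding dilation_integral_def
    by (intro nn_integral_cong) (auto simp: G_def h_def split: split_indicator)
  finally show ?thesis .
qed

section \<open>Finiteness of the limiting constant\<close>

text \<open>Cover the space by the dyadic shells \<open>2\<^sup>k \<le> 1 + |x| < 2\<^sup>k\<^sup>+\<^sup>1\<close>. The shell of index \<open>k\<close> lies in a
  ball of volume proportional to \<open>2\<^sup>k\<^sup>d\<close>, so the integral is at most a multiple of the geometric series
  of ratio \<open>2\<^sup>d\<^sup>-\<^sup>q\<close>.\<close>

lemma nn_integral_norm_powr_finite: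
  fixes q :: real
  assumes q: "real DIM('a::euclidean_space) < q"
  shows "(\<integral>\<^sup>+x. ennreal ((1 + norm (x::'a)) powr - q) \<partial>lborel) < \<infinity>"
proof -
  let ?d = "DIM('a)"
  define V where "V = unit_ball_vol (real ?d)"
  define c where "c k = (2 powr - q) ^ k" for k :: nat
  define B where "B k = cball (0 :: 'a) (2 ^ (k + 1))" for k :: nat
  have "ennreal ((1 + norm x) powr - q) \<le> (\<Sum>k. ennreal (c k) * indicator (B k) x)" for x :: 'a
  proof -
    define y where "y = 1 + norm x"
    have y: "1 \<le> y"
      by (simp add: y_def)
    define k where "k = nat \<lfloor>log 2 y\<rfloor>"
    have "0 \<le> log 2 y"
      using y by simp
    then have k: "real k \<le> log 2 y" "log 2 y < real k + 1"
      unfolding k_def by linarith+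
    have "2 powr real k \<le> y"
      using k(1) y by (simp add: le_log_iff)
    have "y < 2 powr (real k + 1)"
      using k(2) y by (simp add: log_less_iff)
    then have "x \<in> B k"
      by (simp add: B_def y_def powr_add powr_realpow)
    have "y powr - q \<le> (2 powr real k) powr - q"
      using \<open>2 powr real k \<le> y\<close> q by (intro powr_mono2') auto
    also have "\<dots> = c k"
      by (simp add: c_def powr_powr powr_realpow[symmetric] mult.commute)
    finally have "ennreal (y powr - q) \<le> ennreal (c k) * indicator (B k) x"
      using \<open>x \<in> B k\<close> by (simp add: ennreal_leI)
    also have "\<dots> \<le> (\<Sum>k. ennreal (c k) * indicator (B k) x)"
      using sum_le_suminf[OF summableI, of "{k}" "\<lambda>k. ennreal (c k) * indicator (B k) x"]
      by (simp del: sum_mult_indicator)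
    finally show ?thesis
      by (simp add: y_def)
  qed
  then have "(\<integral>\<^sup>+x. ennreal ((1 + norm (x::'a)) powr - q) \<partial>lborel)
      \<le> (\<integral>\<^sup>+x. (\<Sum>k. ennreal (c k) * indicator (B k) x) \<partial>lborel)"
    by (rule nn_integral_mono)
  also have "\<dots> = (\<Sum>k. \<integral>\<^sup>+x. ennreal (c k) * indicator (B k) x \<partial>lborel)"
    by (rule nn_integral_suminf)
      (auto simp: B_def intro!: borel_measurable_times_ennreal borel_measurable_indicator)
  also have "\<dots> = (\<Sum>k. ennreal (V * 2 ^ ?d * (2 powr (real ?d - q)) ^ k))"
  proof (intro suminf_cong)
    fix k
    have ratio: "(2 powr (real ?d - q)) ^ k = c k * (2 ^ ?d) ^ k"
      by (simp add: c_def powr_add[of 2 "real ?d" "- q", simplified] powr_realpow power_mult_distrib)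
    have "(\<integral>\<^sup>+x. ennreal (c k) * indicator (B k) x \<partial>lborel)
        = ennreal (c k * (V * (2 ^ (k + 1)) ^ ?d))"
      by (simp add: nn_integral_cmult_indicator B_def emeasure_cball V_def c_def ennreal_mult
          unit_ball_vol_nonneg)
    also have "c k * (V * (2 ^ (k + 1)) ^ ?d) = V * 2 ^ ?d * (2 powr (real ?d - q)) ^ k"
      by (simp add: ratio power_mult_distrib power_mult[symmetric] mult.commute[of k])
    finally show "(\<integral>\<^sup>+x. ennreal (c k) * indicator (B k) x \<partial>lborel)
        = ennreal (V * 2 ^ ?d * (2 powr (real ?d - q)) ^ k)" .
  qed
  also have "\<dots> = ennreal (\<Sum>k. V * 2 ^ ?d * (2 powr (real ?d - q)) ^ k)"
  proof (rule suminf_ennreal2)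
    have "2 powr (real ?d - q) < (1 :: real)"
      using q powr_less_mono[of "real ?d - q" 0 2] by simp
    then show "summable (\<lambda>k. V * 2 ^ ?d * (2 powr (real ?d - q)) ^ k)"
      by (intro summable_mult summable_geometric) simp
  qed (simp add: V_def unit_ball_vol_nonneg)
  finally show ?thesis
    by (simp add: order_le_less_trans)
qed

text \<open>As \<open>J\<close> is an infimum over all sizes, one size suffices, and the one-point quantizer
  at the origin already has finite distortion on the cube.\<close>

lemma J_const_finite:
  fixes N :: "real^'d \<Rightarrow> real"
  assumes N: "is_norm N" and r: "0 < r"
  shows "J_const N r < \<infinity>"
proof -
  let ?U = "uniform_measure lborel (cbox (0 :: real^'d) 1)"
  have em: "emeasure lborel (cbox (0 :: real^'d) 1) = 1"
    by (subst emeasure_lborel_cbox) (auto simp: inner_axis Basis_vec_def intro!: prod.neutral)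
  have "prob_space ?U"
    by (rule prob_space_uniform_measure) (simp_all add: em)
  have "\<exists>x\<in>cbox (0 :: real^'d) 1. \<forall>y\<in>cbox 0 1. N y \<le> N x"
    by (intro continuous_attains_sup continuous_on_subset[OF continuous_on_is_norm[OF N]])
      (auto simp: box_ne_empty inner_axis Basis_vec_def)
  then obtain b where b: "\<And>y. y \<in> cbox (0 :: real^'d) 1 \<Longrightarrow> N y \<le> b"
    by auto
  have "AE x in ?U. ennreal (N x powr r) \<le> ennreal (b powr r)"
    using N r b by (intro AE_uniform_measureI)
      (auto simp: is_norm_def intro!: AE_I2 ennreal_leI powr_mono2)
  then have "distortion N r ?U {0} \<le> (\<integral>\<^sup>+x. ennreal (b powr r) \<partial>?U)"
    unfolding distortion_def by (intro nn_integral_mono_AE) (simp add: quant_dist_def)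
  also have "\<dots> < top"
    using prob_space.emeasure_space_1[OF \<open>prob_space ?U\<close>] by (subst nn_integral_const) simp
  finally have "epowr (distortion N r ?U {0}) (1 / r) < top"
    by (rule epowr_less_top)
  moreover have "min_quant_error N 1 r ?U \<le> epowr (distortion N r ?U {0}) (1 / r)"
    unfolding min_quant_error_def by (rule INF_lower) simp
  ultimately have "epowr (min_quant_error N 1 r ?U) r < top"
    by (intro epowr_less_top) (rule order_le_less_trans)
  moreover have "J_const N r \<le> ennreal (real 1 powr (r / real CARD('d))) * epowr (min_quant_error N 1 r ?U) r"
    unfolding J_const_def by (rule INF_lower) simp
  ultimately show ?thesis
    by (simp add: order_le_less_trans)
qed

text \<open>Write \<open>f\<^sup>p\<close>, where \<open>p = d / (d + r)\<close>, as \<open>(f w\<^sup>t)\<^sup>p w\<^sup>-\<^sup>t\<^sup>p\<close> with \<open>w = 1 + |x|\<close>. In Hoelder's inequality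
  with exponents \<open>p\<close> and \<open>1 - p\<close> the second factor becomes \<open>w\<close> to the power
  \<open>-t p / (1 - p) = -t d / r\<close>, which is integrable precisely because the moment order \<open>t\<close> exceeds \<open>r\<close>.\<close>

lemma Q_const_finite:
  fixes N :: "real^'d \<Rightarrow> real" and f :: "real^'d \<Rightarrow> real"
  assumes N: "is_norm N" and r: "0 < r" "r < t" and f: "\<And>x. 0 \<le> f x"
    and [measurable]: "f \<in> borel_measurable borel"
    and mass: "(\<integral>\<^sup>+x. ennreal (f x) \<partial>lborel) < \<infinity>"
    and moment: "(\<integral>\<^sup>+x. ennreal (f x) * ennreal (N x powr t) \<partial>lborel) < \<infinity>"
  shows "Q_const N r f < \<infinity>"
proof -
  note borel_measurable_is_norm[OF N, measurable]
  define d where "d = real CARD('d)"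
  have d: "0 < d"
    by (simp add: d_def)
  define p where "p = d / (d + r)"
  have p: "0 < p" "p < 1"
    using d r by (auto simp: p_def)
  define q where "q = t * d / r"
  have "d < q"
    using d r by (simp add: q_def field_simps)
  define w where "w x = 1 + norm x" for x :: "real^'d"
  have [measurable]: "w \<in> borel_measurable borel"
    by (simp add: w_def[abs_def])
  have w: "1 \<le> w x" for x
    by (simp add: w_def)
  obtain K where K: "0 < K" "\<And>x. norm x \<le> K * N x"
    using norm_le_is_norm[OF N] by blast
  \<comment> \<open>For \<open>|x| \<le> 1\<close> the weight is at most \<open>2\<close>, otherwise at most \<open>2 |x|\<close>.\<close>
  have w_le: "w x powr t \<le> 2 powr t + (2 * K) powr t * N x powr t" for x
  proof -
    have N0: "0 \<le> N x"
      using N by (simp add: is_norm_def)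
    show ?thesis
    proof (cases "norm x \<le> 1")
      case True
      then have "w x powr t \<le> 2 powr t"
        using r w[of x] by (intro powr_mono2) (auto simp: w_def)
      then show ?thesis
        by (simp add: add_increasing2)
    next
      case False
      then have "w x \<le> 2 * K * N x"
        using K(2)[of x] by (simp add: w_def)
      then have "w x powr t \<le> (2 * K * N x) powr t"
        using r w[of x] by (intro powr_mono2) auto
      also have "\<dots> = (2 * K) powr t * N x powr t"
        using K N0 by (simp add: powr_mult)
      finally show ?thesis
        by (simp add: add_increasing)
    qed
  qed
  have "(\<integral>\<^sup>+x. ennreal (f x * w x powr t) \<partial>lborel)
      \<le> (\<integral>\<^sup>+x. ennreal (2 powr t) * ennreal (f x)
          + ennreal ((2 * K) powr t) * (ennreal (f x) * ennreal (N x powr t)) \<partial>lborel)"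
  proof (rule nn_integral_mono)
    fix x
    have "f x * w x powr t \<le> 2 powr t * f x + (2 * K) powr t * (f x * N x powr t)"
      using mult_left_mono[OF w_le[of x] f[of x]] by (simp add: algebra_simps)
    then show "ennreal (f x * w x powr t) \<le> ennreal (2 powr t) * ennreal (f x)
          + ennreal ((2 * K) powr t) * (ennreal (f x) * ennreal (N x powr t))"
      using f[of x] by (simp add: ennreal_mult[symmetric] ennreal_plus[symmetric] ennreal_leI del: ennreal_plus)
  qed
  also have "\<dots> = ennreal (2 powr t) * (\<integral>\<^sup>+x. ennreal (f x) \<partial>lborel)
      + ennreal ((2 * K) powr t) * (\<integral>\<^sup>+x. ennreal (f x) * ennreal (N x powr t) \<partial>lborel)"
    by (simp add: nn_integral_add nn_integral_cmult)
  also have "\<dots> < top"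
    using mass moment by (simp add: ennreal_mult_less_top)
  finally have A: "(\<integral>\<^sup>+x. ennreal (f x * w x powr t) \<partial>lborel) < top" .
  have B: "(\<integral>\<^sup>+x. ennreal (w x powr - q) \<partial>lborel) < top"
    using nn_integral_norm_powr_finite[where 'a = "real^'d", of q] \<open>d < q\<close> by (simp add: w_def d_def)
  have "f x powr p = (f x * w x powr t) powr p * (w x powr - q) powr (1 - p)" for x
  proof -
    have "q * (1 - p) = t * p"
      using d r by (simp add: p_def q_def diff_divide_eq_iff)
    then have "(f x * w x powr t) powr p * (w x powr - q) powr (1 - p)
        = f x powr p * (w x powr (t * p) * w x powr - (t * p))"
      using f[of x] by (simp add: powr_mult powr_powr)
    also have "w x powr (t * p) * w x powr - (t * p) = 1"
      using w[of x] by (simp add: powr_add[symmetric])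
    finally show ?thesis
      by simp
  qed
  then have "(\<integral>\<^sup>+x. ennreal (f x powr p) \<partial>lborel)
      \<le> epowr (\<integral>\<^sup>+x. ennreal (f x * w x powr t) \<partial>lborel) p
        * epowr (\<integral>\<^sup>+x. ennreal (w x powr - q) \<partial>lborel) (1 - p)"
    using nn_integral_Hoelder[of "\<lambda>x. f x * w x powr t" lborel "\<lambda>x. w x powr - q" p] f p by simp
  also have "\<dots> < top"
    using A B by (simp add: ennreal_mult_less_top epowr_less_top)
  finally have "(\<integral>\<^sup>+x. ennreal (f x powr p) \<partial>lborel) < top" .
  then show ?thesis
    using J_const_finite[OF N r(1)]
    by (simp add: Q_const_def ennreal_mult_less_top epowr_less_top p_def d_def)
qed

section \<open>Dilated optimal quantizers\<close>

theorem theorem3p1: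
  fixes N :: "real^'d \<Rightarrow> real"
    and M :: "'a measure" and X :: "'a \<Rightarrow> real^'d"
    and f :: "real^'d \<Rightarrow> real"
    and r s \<theta> \<eta> :: real and \<mu> :: "real^'d"
    and \<alpha> :: "nat \<Rightarrow> (real^'d) set"
  assumes "is_norm N"
    and "0 < s" and "0 < r" and "s < r"
    and "prob_space M"
    and "\<And>x. 0 \<le> f x"
    and "distributed M lborel X (\<lambda>x. ennreal (f x))"
    and "0 < \<theta>" and "admissible f \<theta> \<mu>"
    and "0 < \<eta>" and "(\<integral>\<^sup>+\<omega>. ennreal (N (X \<omega>) powr (r + \<eta>)) \<partial>M) < \<infinity>"
    and "asymptotically_optimal N r f \<alpha>"
    and "dilation_integral r s f \<theta> \<mu> < \<infinity>"
  shows "rate_optimal N s (density lborel (\<lambda>x. ennreal (f x))) (\<lambda>n. dilate_set \<theta> \<mu> (\<alpha> n)) \<and>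
    (\<forall>\<pi>. (\<forall>n\<ge>1. voronoi_projection N (dilate_set \<theta> \<mu> (\<alpha> n)) (\<pi> n)) \<longrightarrow>
      limsup (\<lambda>n. ennreal (real n powr (s / real CARD('d))) *
                  epowr (Lnorm N M s (\<lambda>\<omega>. X \<omega> - \<pi> n (X \<omega>))) s)
        \<le> ennreal (\<theta> powr (s + real CARD('d))) * epowr (Q_const N r f) (s / r) *
          epowr (dilation_integral r s f \<theta> \<mu>) (1 - s / r))"
proof -
  interpret prob_space M by fact
  let ?P = "density lborel (\<lambda>x. ennreal (f x))"
  let ?d = "real CARD('d)"
  let ?D = "epowr (dilation_integral r s f \<theta> \<mu>) (1 - s / r)"
  let ?C = "ennreal (\<theta> powr (s + ?d))"
  let ?bound = "?C * epowr (Q_const N r f) (s / r) * ?D"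
  let ?\<beta> = "\<lambda>n. dilate_set \<theta> \<mu> (\<alpha> n)"
  note borel_measurable_is_norm[OF assms(1), measurable]
  note dist = assms(7)
  have f_meas: "f \<in> borel_measurable borel"
    using distributed_real_measurable[OF _ dist] assms(6) by simp
  have "(\<integral>\<^sup>+x. ennreal (f x) \<partial>lborel) = 1"
    using distributed_nn_integral[OF dist, of "\<lambda>_. 1"] emeasure_space_1 by simp
  moreover have "(\<integral>\<^sup>+x. ennreal (f x) * ennreal (N x powr (r + \<eta>)) \<partial>lborel) < \<infinity>"
    using assms(11) by (subst distributed_nn_integral[OF dist]) simp_all
  ultimately have Q: "Q_const N r f < \<infinity>"
    using assms(1,3,6,10) f_meas by (intro Q_const_finite[where t = "r + \<eta>"]) auto
  have D: "?D < top"
    using assms(13) by (simp add: epowr_less_top)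
  have quant: "quantizer_seq \<alpha>"
    and lim: "(\<lambda>n. ennreal (real n powr (r / ?d)) * distortion N r ?P (\<alpha> n)) \<longlonglongrightarrow> Q_const N r f"
    using assms(12) by (simp_all add: asymptotically_optimal_def)
  define u where "u n = ?C * (epowr (ennreal (real n powr (r / ?d)) * distortion N r ?P (\<alpha> n)) (s / r) * ?D)"
    for n
  have "u \<longlonglongrightarrow> ?C * (epowr (Q_const N r f) (s / r) * ?D)"
    unfolding u_def using Q D assms(2,3)
    by (subst (1 2) mult.commute[of _ ?D]) (intro ennreal_tendsto_cmult tendsto_epowr[OF lim], auto)
  then have u_lim: "limsup u = ?bound"
    by (simp add: lim_imp_Limsup mult.assoc)
  have le_u: "ennreal (real n powr (s / ?d)) * distortion N s ?P (?\<beta> n) \<le> u n" if "1 \<le> n" for n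
  proof -
    have "epowr (ennreal (real n powr (r / ?d))) (s / r) = ennreal (real n powr (s / ?d))"
      using assms(3) by (simp add: powr_powr)
    moreover have "distortion N s ?P (?\<beta> n)
        \<le> ?C * (epowr (distortion N r ?P (\<alpha> n)) (s / r) * ?D)"
      using quant that by (intro distortion_dilate_le assms f_meas) (auto simp: quantizer_seq_def)
    ultimately show ?thesis
      by (auto simp: u_def epowr_mult mult_ac dest: mult_left_mono[of _ _ "ennreal (real n powr (s / ?d))"])
  qed
  have "limsup (\<lambda>n. ennreal (real n powr (s / ?d)) * distortion N s ?P (?\<beta> n)) \<le> limsup u"
    by (intro Limsup_mono eventually_sequentiallyI[of 1] le_u)
  then have main: "limsup (\<lambda>n. ennreal (real n powr (s / ?d)) * distortion N s ?P (?\<beta> n)) \<le> ?bound"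
    by (simp add: u_lim)
  have "?bound < top"
    using Q D by (simp add: ennreal_mult_less_top epowr_less_top)
  with main have "rate_optimal N s ?P ?\<beta>"
    by (simp add: rate_optimal_def quantizer_seq_dilate[OF quant] order_le_less_trans)
  moreover have "limsup (\<lambda>n. ennreal (real n powr (s / ?d))
      * epowr (Lnorm N M s (\<lambda>\<omega>. X \<omega> - \<pi> n (X \<omega>))) s) \<le> ?bound"
    if \<pi>: "\<forall>n\<ge>1. voronoi_projection N (?\<beta> n) (\<pi> n)" for \<pi>
  proof -
    have "epowr (Lnorm N M s (\<lambda>\<omega>. X \<omega> - \<pi> n (X \<omega>))) s = distortion N s ?P (?\<beta> n)" if "1 \<le> n" for n
      using that \<pi> assms(1,2) quantizer_seq_dilate[OF quant] dist
      by (intro distortion_eq_Lnorm) (auto simp: quantizer_seq_def)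
    then have "limsup (\<lambda>n. ennreal (real n powr (s / ?d))
        * epowr (Lnorm N M s (\<lambda>\<omega>. X \<omega> - \<pi> n (X \<omega>))) s)
      \<le> limsup (\<lambda>n. ennreal (real n powr (s / ?d)) * distortion N s ?P (?\<beta> n))"
      by (intro Limsup_mono eventually_sequentiallyI[of 1]) simp
    with main show ?thesis
      by (rule order.trans[rotated])
  qed
  ultimately show ?thesis
    by blast
qed

end
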